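(* Let $F$ be a field of characteristic different from $2$, let $A_n$ be a $2^n$-dimensional Cayley--Dickson algebra over $F$, and put $m=2^n-1$. Let $f(x)=x^2+f_1(x)+r$ be a monic quadratic general polynomial over $A_n$. Identify $A_n$ with $F^{m+1}$ via $t+\sum_{i=1}^m x_ie_i\leftrightarrow(t,x_1,\dots,x_m)$, and let $Q_f\subset F^{m+1}$ be the quadric $$t^2+\alpha_1x_1^2+\dots+\alpha_mx_m^2+G_0(t,x_1,\dots,x_m)+r_0=0 .$$ Then the set of solutions of $f(x)=0$ in $A_n$ consists of a finite set of isolated points together with the union of the intersections of $Q_f$ with at most $m$ affine subspaces of $F^{m+1}$ of positive dimension. Moreover, the total number of these isolated points and affine subspaces does not exceed $2m+2$.
   Context: Cayley--Dickson algebras: given an $F$-algebra $A$ with involution $a\mapsto\bar a$ and $\gamma\in F^\times$, the doubling $A\{\gamma\}=A\oplus A\ell$ has componentwise addition and scalar multiplication, product $(q+r\ell)(s+t\ell)=qs+\gamma\,\bar t r+(tq+r\bar s)\ell$, and involution $\overline{q+r\ell}=\bar q-r\ell$. Start with $A_0=F$ (trivial involution) and let $A_{k}=A_{k-1}\{\gamma_{k}\}$ for arbitrary $\gamma_k\in F^\times$, with new generator $\ell_k$; $A_n$ is the result after $n$ steps. Standard basis: $e_0=1$ for $A_0$; the basis of $A_{k+1}$ is the basis $e_0,\dots,e_{2^k-1}$ of $A_k$ followed by $e_{2^k+j}=e_j\ell_{k+1}$, $0\le j\le 2^k-1$. Thus $A_n$ has basis $e_0=1,e_1,\dots,e_m$;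 one has $e_ie_j=-e_je_i$ for distinct $i,j\ge1$, and $\alpha_i:=e_i^2\in F$ for $i\ge1$. A monic quadratic general polynomial over $A_n$ is an expression $f(x)=x^2+f_1(x)+r$ with $r\in A_n$ and $f_1(x)$ a finite sum of linear terms, where a linear term is a product of elements of $A_n$ and precisely one occurrence of $x$, in any order and with any bracketing (the variable neither commutes nor associates with the coefficients). It is evaluated at elements of $A_n$ by substitution. Notation: $r=\sum_{i=0}^m r_ie_i$ with $r_i\in F$; $f_1(x)=\sum_{i=0}^mG_i(x)e_i$, where the $G_i:A_n\to F$ are $F$-linear, regarded as linear forms $G_i(t,x_1,\dots,x_m)=g_{i,0}t+g_{i,1}x_1+\dots+g_{i,m}x_m$ with $g_{i,k}\in F$, for $x=t+\sum_{i=1}^mx_ie_i$. The isolated points are roots $x=t+\sum_{i\ge1} x_ie_i$ that are the unique root with the given value of $t$. *)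

theory Defs
  imports "Jordan_Normal_Form.VS_Connect"
begin

text \<open>
  The algebra \<open>A\<^sub>n\<close> is represented by its coordinates with respect to the standard
  basis: its carrier is \<open>carrier_vec (2 ^ n)\<close>, and \<open>e\<^sub>i\<close> is \<open>unit_vec (2 ^ n) i\<close>. Since the
  standard basis of \<open>A\<^sub>k\<^sub>+\<^sub>1\<close> is that of \<open>A\<^sub>k\<close> followed by (lemma \<open>cd_basis_step\<close>) the elements \<open>e\<^sub>j \<ell>\<^sub>k\<^sub>+\<^sub>1\<close>, the element
  \<open>q + r \<ell>\<^sub>k\<^sub>+\<^sub>1\<close> has the coordinate vector \<open>q @\<^sub>v r\<close>. Addition and scalar multiplication are
  those of vectors, and the identification of \<open>A\<^sub>n\<close> with \<open>F\<^sup>m\<^sup>+\<^sup>1\<close> is the identity.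
\<close>

primrec cd_conj :: "nat \<Rightarrow> 'a :: field vec \<Rightarrow> 'a vec" where
  "cd_conj 0 x = x"
| "cd_conj (Suc k) x = cd_conj k (vec_first x (2 ^ k)) @\<^sub>v (- vec_last x (2 ^ k))"

text \<open>The parameters are indexed from 1, as in \<open>A\<^sub>k = A\<^sub>k\<^sub>-\<^sub>1{\<gamma>\<^sub>k}\<close>.\<close>

primrec cd_mult :: "(nat \<Rightarrow> 'a :: field) \<Rightarrow> nat \<Rightarrow> 'a vec \<Rightarrow> 'a vec \<Rightarrow> 'a vec" where
  "cd_mult \<gamma> 0 x y = vec 1 (\<lambda>_. x $ 0 * y $ 0)"
| "cd_mult \<gamma> (Suc k) x y =
    (let q = vec_first x (2 ^ k); r = vec_last x (2 ^ k);
         s = vec_first y (2 ^ k); t = vec_last y (2 ^ k)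
     in (cd_mult \<gamma> k q s + \<gamma> (Suc k) \<cdot>\<^sub>v cd_mult \<gamma> k (cd_conj k t) r)
        @\<^sub>v (cd_mult \<gamma> k t q + cd_mult \<gamma> k r (cd_conj k s)))"

text \<open>The square of \<open>e\<^sub>i\<close> is a multiple of \<open>e\<^sub>0\<close> (lemma \<open>cd_basis_square\<close>); \<open>cd_alpha\<close> is the factor.\<close>

definition cd_alpha :: "(nat \<Rightarrow> 'a :: field) \<Rightarrow> nat \<Rightarrow> nat \<Rightarrow> 'a" where
  "cd_alpha \<gamma> n i = cd_mult \<gamma> n (unit_vec (2 ^ n) i) (unit_vec (2 ^ n) i) $ 0"

text \<open>Bracketed products of coefficients and occurrences of the variable.\<close>

datatype 'c gen_monomial = Var | Const 'c | Prod "'c gen_monomial" "'c gen_monomial"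

primrec num_vars :: "'c gen_monomial \<Rightarrow> nat" where
  "num_vars Var = 1"
| "num_vars (Const a) = 0"
| "num_vars (Prod S T) = num_vars S + num_vars T"

definition linear_term :: "nat \<Rightarrow> 'a vec gen_monomial \<Rightarrow> bool" where
  "linear_term n T \<longleftrightarrow> num_vars T = 1 \<and> set_gen_monomial T \<subseteq> carrier_vec (2 ^ n)"

primrec monomial_eval ::
  "(nat \<Rightarrow> 'a :: field) \<Rightarrow> nat \<Rightarrow> 'a vec gen_monomial \<Rightarrow> 'a vec \<Rightarrow> 'a vec" where
  "monomial_eval \<gamma> n Var x = x"
| "monomial_eval \<gamma> n (Const a) x = a"
| "monomial_eval \<gamma> n (Prod S T) x = cd_mult \<gamma> n (monomial_eval \<gamma> n S x) (monomial_eval \<gamma> n T x)"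

text \<open>
  A monic quadratic general polynomial \<open>x\<^sup>2 + f\<^sub>1(x) + r\<close> is given by the list \<open>Ts\<close> of the
  linear terms whose sum is \<open>f\<^sub>1\<close> and by its constant term \<open>r\<close>.
\<close>

definition linear_part ::
  "(nat \<Rightarrow> 'a :: field) \<Rightarrow> nat \<Rightarrow> 'a vec gen_monomial list \<Rightarrow> 'a vec \<Rightarrow> 'a vec" where
  "linear_part \<gamma> n Ts x = foldr (\<lambda>T s. monomial_eval \<gamma> n T x + s) Ts (0\<^sub>v (2 ^ n))"

definition monic_quadratic_eval ::
  "(nat \<Rightarrow> 'a :: field) \<Rightarrow> nat \<Rightarrow> 'a vec gen_monomial list \<Rightarrow> 'a vec \<Rightarrow> 'a vec \<Rightarrow> 'a vec" where
  "monic_quadratic_eval \<gamma> n Ts r x = cd_mult \<gamma> n x x + linear_part \<gamma> n Ts x + r"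

definition roots ::
  "(nat \<Rightarrow> 'a :: field) \<Rightarrow> nat \<Rightarrow> 'a vec gen_monomial list \<Rightarrow> 'a vec \<Rightarrow> 'a vec set" where
  "roots \<gamma> n Ts r = {x \<in> carrier_vec (2 ^ n). monic_quadratic_eval \<gamma> n Ts r x = 0\<^sub>v (2 ^ n)}"

definition isolated_points ::
  "(nat \<Rightarrow> 'a :: field) \<Rightarrow> nat \<Rightarrow> 'a vec gen_monomial list \<Rightarrow> 'a vec \<Rightarrow> 'a vec set" where
  "isolated_points \<gamma> n Ts r =
    {x \<in> roots \<gamma> n Ts r. \<forall>y \<in> roots \<gamma> n Ts r. y $ 0 = x $ 0 \<longrightarrow> y = x}"

text \<open>
  The coefficient \<open>g\<^sub>i\<^sub>,\<^sub>k = G\<^sub>i(e\<^sub>k)\<close>; by linearity of \<open>f\<^sub>1\<close> these give all values of the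
  forms \<open>G\<^sub>i\<close> (lemma \<open>linear_part_eq\<close>).
\<close>

definition linear_coeff ::
  "(nat \<Rightarrow> 'a :: field) \<Rightarrow> nat \<Rightarrow> 'a vec gen_monomial list \<Rightarrow> nat \<Rightarrow> nat \<Rightarrow> 'a" where
  "linear_coeff \<gamma> n Ts i k = linear_part \<gamma> n Ts (unit_vec (2 ^ n) k) $ i"

definition linear_form ::
  "(nat \<Rightarrow> 'a :: field) \<Rightarrow> nat \<Rightarrow> 'a vec gen_monomial list \<Rightarrow> nat \<Rightarrow> 'a vec \<Rightarrow> 'a" where
  "linear_form \<gamma> n Ts i v = (\<Sum>k<2 ^ n. linear_coeff \<gamma> n Ts i k * v $ k)"

definition quadric ::
  "(nat \<Rightarrow> 'a :: field) \<Rightarrow> nat \<Rightarrow> 'a vec gen_monomial list \<Rightarrow> 'a vec \<Rightarrow> 'a vec set" where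
  "quadric \<gamma> n Ts r =
    {v \<in> carrier_vec (2 ^ n).
      (v $ 0)\<^sup>2 + (\<Sum>i = 1..2 ^ n - 1. cd_alpha \<gamma> n i * (v $ i)\<^sup>2)
        + linear_form \<gamma> n Ts 0 v + r $ 0 = 0}"

definition affine_subspace :: "nat \<Rightarrow> nat \<Rightarrow> 'a :: field vec set \<Rightarrow> bool" where
  "affine_subspace N d L \<longleftrightarrow>
    (\<exists>p \<in> carrier_vec N. \<exists>W. VectorSpace.subspace class_ring W (module_vec TYPE('a) N)
      \<and> vectorspace.dim class_ring ((module_vec TYPE('a) N)\<lparr>carrier := W\<rparr>) = d
      \<and> L = (\<lambda>w. p + w) ` W)"

lemma cd_conj_carrier: "x \<in> carrier_vec (2 ^ n) \<Longrightarrow> cd_conj n x \<in> carrier_vec (2 ^ n)"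
proof (induction n arbitrary: x)
  case (Suc n)
  have "cd_conj n (vec_first x (2 ^ n)) @\<^sub>v - vec_last x (2 ^ n) \<in> carrier_vec (2 ^ n + 2 ^ n)"
    by (intro append_carrier_vec Suc.IH) auto
  then show ?case by (simp add: mult_2)
qed simp

lemma cd_mult_carrier:
  "x \<in> carrier_vec (2 ^ n) \<Longrightarrow> y \<in> carrier_vec (2 ^ n) \<Longrightarrow> cd_mult \<gamma> n x y \<in> carrier_vec (2 ^ n)"
proof (induction n arbitrary: x y)
  case (Suc n)
  show ?case
    using append_carrier_vec[of _ "2 ^ n" _ "2 ^ n"]
    by (simp add: Let_def mult_2 Suc.IH cd_conj_carrier)
qed auto

lemma vec_first_lin:
  assumes "x \<in> carrier_vec (k + l)" "y \<in> carrier_vec (k + l)"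
  shows "vec_first (x + c \<cdot>\<^sub>v y) k = vec_first x k + c \<cdot>\<^sub>v vec_first y k"
    "vec_last (x + c \<cdot>\<^sub>v y) l = vec_last x l + c \<cdot>\<^sub>v vec_last y l"
  using assms by (auto simp: vec_first_def vec_last_def)

lemma append_lin:
  assumes "a \<in> carrier_vec k" "b \<in> carrier_vec k" "a' \<in> carrier_vec l" "b' \<in> carrier_vec l"
  shows "(a @\<^sub>v a') + c \<cdot>\<^sub>v (b @\<^sub>v b') = (a + c \<cdot>\<^sub>v b) @\<^sub>v (a' + (c :: 'a :: field) \<cdot>\<^sub>v b')"
  using assms by (intro eq_vecI) (auto simp: append_vec_def Let_def)

lemma cd_conj_lin:
  assumes "x \<in> carrier_vec (2 ^ n)" "y \<in> carrier_vec (2 ^ n)"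
  shows "cd_conj n (x + c \<cdot>\<^sub>v y) = cd_conj n x + c \<cdot>\<^sub>v cd_conj n y"
  using assms
proof (induction n arbitrary: x y)
  case (Suc n)
  have xy: "x \<in> carrier_vec (2 ^ n + 2 ^ n)" "y \<in> carrier_vec (2 ^ n + 2 ^ n)"
    using Suc.prems by (auto simp: mult_2)
  have "- (vec_last x (2 ^ n) + c \<cdot>\<^sub>v vec_last y (2 ^ n))
      = - vec_last x (2 ^ n) + c \<cdot>\<^sub>v - vec_last y (2 ^ n)"
    by (intro eq_vecI) auto
  then show ?case
    by (simp add: vec_first_lin[OF xy] Suc.IH append_lin[where k = "2 ^ n" and l = "2 ^ n"]
        cd_conj_carrier)
qed simp

lemma cd_mult_lin:
  assumes "x \<in> carrier_vec (2 ^ n)" "y \<in> carrier_vec (2 ^ n)" "z \<in> carrier_vec (2 ^ n)"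
  shows "cd_mult \<gamma> n (x + c \<cdot>\<^sub>v y) z = cd_mult \<gamma> n x z + c \<cdot>\<^sub>v cd_mult \<gamma> n y z \<and>
    cd_mult \<gamma> n z (x + c \<cdot>\<^sub>v y) = cd_mult \<gamma> n z x + c \<cdot>\<^sub>v cd_mult \<gamma> n z y"
  using assms
proof (induction n arbitrary: x y z)
  case 0
  then show ?case by (auto simp: algebra_simps)
next
  case (Suc n)
  have xy: "x \<in> carrier_vec (2 ^ n + 2 ^ n)" "y \<in> carrier_vec (2 ^ n + 2 ^ n)"
    using Suc.prems by (auto simp: mult_2)
  have IH1: "cd_mult \<gamma> n (a + c \<cdot>\<^sub>v b) d = cd_mult \<gamma> n a d + c \<cdot>\<^sub>v cd_mult \<gamma> n b d"
    and IH2: "cd_mult \<gamma> n d (a + c \<cdot>\<^sub>v b) = cd_mult \<gamma> n d a + c \<cdot>\<^sub>v cd_mult \<gamma> n d b"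
    if "a \<in> carrier_vec (2 ^ n)" "b \<in> carrier_vec (2 ^ n)" "d \<in> carrier_vec (2 ^ n)" for a b d
    using Suc.IH[OF that] by auto
  have shuffle: "(a + c \<cdot>\<^sub>v b) + g \<cdot>\<^sub>v (a' + c \<cdot>\<^sub>v b') = (a + g \<cdot>\<^sub>v a') + c \<cdot>\<^sub>v (b + g \<cdot>\<^sub>v b')"
    and shuffle1: "(a + c \<cdot>\<^sub>v b) + (a' + c \<cdot>\<^sub>v b') = (a + a') + c \<cdot>\<^sub>v (b + b')"
    if "a \<in> carrier_vec (2 ^ n)" "b \<in> carrier_vec (2 ^ n)"
       "a' \<in> carrier_vec (2 ^ n)" "b' \<in> carrier_vec (2 ^ n)" for a b a' b' :: "'a vec" and g
    using that by (auto intro!: eq_vecI simp: algebra_simps)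
  show ?case
    by (simp add: Let_def vec_first_lin[OF xy] IH1 IH2 cd_conj_lin cd_conj_carrier
        cd_mult_carrier shuffle shuffle1 append_lin[where k = "2 ^ n" and l = "2 ^ n"])
qed

lemma cd_conj_zero: "cd_conj n (0\<^sub>v (2 ^ n)) = 0\<^sub>v (2 ^ n)"
proof (induction n)
  case (Suc n)
  have "vec_first (0\<^sub>v (2 * 2 ^ n)) (2 ^ n) = (0\<^sub>v (2 ^ n) :: 'a vec)"
    "- vec_last (0\<^sub>v (2 * 2 ^ n)) (2 ^ n) = (0\<^sub>v (2 ^ n) :: 'a vec)"
    by (auto intro!: eq_vecI simp: vec_first_def vec_last_def)
  moreover have "0\<^sub>v (2 ^ n) @\<^sub>v 0\<^sub>v (2 ^ n) = (0\<^sub>v (2 * 2 ^ n) :: 'a vec)"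
    by (auto intro!: eq_vecI simp: append_vec_def Let_def)
  ultimately show ?case using Suc.IH by simp
qed simp

lemma cd_mult_zero:
  assumes "x \<in> carrier_vec (2 ^ n)"
  shows "cd_mult \<gamma> n (0\<^sub>v (2 ^ n)) x = 0\<^sub>v (2 ^ n)" "cd_mult \<gamma> n x (0\<^sub>v (2 ^ n)) = 0\<^sub>v (2 ^ n)"
proof -
  have z: "0\<^sub>v (2 ^ n) + (- 1) \<cdot>\<^sub>v 0\<^sub>v (2 ^ n) = (0\<^sub>v (2 ^ n) :: 'a vec)" by auto
  have c: "v = 0\<^sub>v (2 ^ n)" if v: "v = v + (- 1) \<cdot>\<^sub>v v" "v \<in> carrier_vec (2 ^ n)" for v :: "'a vec"
  proof -
    have "v + (- 1) \<cdot>\<^sub>v v = 0\<^sub>v (2 ^ n)" using v(2) by (intro eq_vecI) auto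
    then show ?thesis using v(1) by simp
  qed
  have lin: "cd_mult \<gamma> n (0\<^sub>v (2 ^ n)) x = cd_mult \<gamma> n (0\<^sub>v (2 ^ n)) x + (- 1) \<cdot>\<^sub>v cd_mult \<gamma> n (0\<^sub>v (2 ^ n)) x"
    "cd_mult \<gamma> n x (0\<^sub>v (2 ^ n)) = cd_mult \<gamma> n x (0\<^sub>v (2 ^ n)) + (- 1) \<cdot>\<^sub>v cd_mult \<gamma> n x (0\<^sub>v (2 ^ n))"
    using cd_mult_lin[of "0\<^sub>v (2 ^ n)" n "0\<^sub>v (2 ^ n)" x \<gamma> "- 1"] z assms by auto
  show "cd_mult \<gamma> n (0\<^sub>v (2 ^ n)) x = 0\<^sub>v (2 ^ n)" "cd_mult \<gamma> n x (0\<^sub>v (2 ^ n)) = 0\<^sub>v (2 ^ n)"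
    by (rule c[OF lin(1)], simp add: cd_mult_carrier assms)
       (rule c[OF lin(2)], simp add: cd_mult_carrier assms)
qed

lemmas cd_zero = cd_conj_zero cd_mult_zero

lemma basis_split:
  assumes "j < 2 ^ n"
  shows "unit_vec (2 ^ Suc n) j = unit_vec (2 ^ n) j @\<^sub>v 0\<^sub>v (2 ^ n)"
    "unit_vec (2 ^ Suc n) (2 ^ n + j) = 0\<^sub>v (2 ^ n) @\<^sub>v unit_vec (2 ^ n) j"
  using assms by (auto intro!: eq_vecI simp: append_vec_def Let_def unit_vec_def)

lemma split_append:
  shows "a \<in> carrier_vec k \<Longrightarrow> vec_first (a @\<^sub>v b) k = a"
    "b \<in> carrier_vec l \<Longrightarrow> vec_last (a @\<^sub>v b) l = b"
  by (auto intro!: eq_vecI simp: vec_first_def vec_last_def)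

lemma cd_conj_basis:
  "i < 2 ^ n \<Longrightarrow> cd_conj n (unit_vec (2 ^ n) i) =
    (if i = 0 then unit_vec (2 ^ n) i else - unit_vec (2 ^ n) i)"
proof (induction n arbitrary: i)
  case (Suc n)
  show ?case
  proof (cases "i < 2 ^ n")
    case True
    have "- (a @\<^sub>v b) = - a @\<^sub>v - b" for a b :: "'a vec"
      by (intro eq_vecI) (auto simp: append_vec_def Let_def)
    moreover have "- 0\<^sub>v (2 ^ n) = (0\<^sub>v (2 ^ n) :: 'a vec)" by (intro eq_vecI) auto
    ultimately show ?thesis unfolding basis_split(1)[OF True]
      using Suc.IH[OF True] by (simp add: split_append)
  next
    case False
    define j where "j = i - 2 ^ n"
    have ij: "i = 2 ^ n + j" and j: "j < 2 ^ n" using False Suc.prems by (auto simp: j_def)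
    have "- (a @\<^sub>v b) = - a @\<^sub>v - b" for a b :: "'a vec"
      by (intro eq_vecI) (auto simp: append_vec_def Let_def)
    moreover have "- 0\<^sub>v (2 ^ n) = (0\<^sub>v (2 ^ n) :: 'a vec)" by (intro eq_vecI) auto
    ultimately show ?thesis unfolding ij basis_split(2)[OF j]
      by (simp add: split_append cd_zero)
  qed
qed auto

lemma smult_zero_vec: "(c :: 'a :: field) \<cdot>\<^sub>v 0\<^sub>v k = 0\<^sub>v k"
  by (intro eq_vecI) auto

lemma cd_mult_one:
  "x \<in> carrier_vec (2 ^ n) \<Longrightarrow> cd_mult \<gamma> n (unit_vec (2 ^ n) 0) x = x \<and>
    cd_mult \<gamma> n x (unit_vec (2 ^ n) 0) = x"
proof (induction n arbitrary: x)
  case 0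
  then show ?case by (auto intro!: eq_vecI)
next
  case (Suc n)
  have z: "(0::nat) < 2 ^ n" by simp
  have x: "vec_first x (2 ^ n) @\<^sub>v vec_last x (2 ^ n) = x"
    using Suc.prems by (intro vec_first_last_append) (simp add: mult_2)
  show ?case unfolding basis_split(1)[OF z]
    by (simp add: split_append Let_def Suc.IH cd_zero cd_conj_basis cd_conj_carrier smult_zero_vec x)
qed

lemma cd_basis_step:
  assumes "j < 2 ^ n"
  shows "unit_vec (2 ^ Suc n) (2 ^ n + j) =
    cd_mult \<gamma> (Suc n) (unit_vec (2 ^ Suc n) j) (unit_vec (2 ^ Suc n) (2 ^ n))"
proof -
  have l: "unit_vec (2 ^ Suc n) (2 ^ n) = 0\<^sub>v (2 ^ n) @\<^sub>v (unit_vec (2 ^ n) 0 :: 'a vec)"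
    using basis_split(2)[of 0 n] by simp
  show ?thesis unfolding l basis_split[OF assms]
    by (simp add: split_append Let_def cd_mult_one cd_zero cd_conj_carrier smult_zero_vec)
qed

lemma cd_basis_square:
  assumes "i < 2 ^ n"
  shows "cd_mult \<gamma> n (unit_vec (2 ^ n) i) (unit_vec (2 ^ n) i) =
    cd_alpha \<gamma> n i \<cdot>\<^sub>v unit_vec (2 ^ n) 0"
proof -
  have "\<exists>a. cd_mult \<gamma> n (unit_vec (2 ^ n) i) (unit_vec (2 ^ n) i) = a \<cdot>\<^sub>v unit_vec (2 ^ n) 0"
    using assms
  proof (induction n arbitrary: i)
    case 0
    then show ?case by (intro exI[of _ 1]) (auto intro!: eq_vecI)
  next
    case (Suc n)
    have z: "(0::nat) < 2 ^ n" by simp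
    have sm: "a \<cdot>\<^sub>v (u @\<^sub>v 0\<^sub>v (2 ^ n)) = a \<cdot>\<^sub>v u @\<^sub>v 0\<^sub>v (2 ^ n)" for a and u :: "'a vec"
      by (intro eq_vecI) (auto simp: append_vec_def Let_def)
    show ?case
    proof (cases "i < 2 ^ n")
      case True
      then obtain a where "cd_mult \<gamma> n (unit_vec (2 ^ n) i) (unit_vec (2 ^ n) i) =
        a \<cdot>\<^sub>v unit_vec (2 ^ n) 0" using Suc.IH by blast
      then show ?thesis unfolding basis_split(1)[OF True] basis_split(1)[OF z] sm
        by (intro exI[of _ a]) (simp add: split_append Let_def cd_zero cd_conj_carrier smult_zero_vec)
    next
      case False
      define j where "j = i - 2 ^ n"
      have ij: "i = 2 ^ n + j" and j: "j < 2 ^ n" using False Suc.prems by (auto simp: j_def)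
      obtain a where a: "cd_mult \<gamma> n (unit_vec (2 ^ n) j) (unit_vec (2 ^ n) j) =
        a \<cdot>\<^sub>v unit_vec (2 ^ n) 0" using Suc.IH[OF j] by blast
      have neg: "- unit_vec (2 ^ n) j = 0\<^sub>v (2 ^ n) + (- 1) \<cdot>\<^sub>v (unit_vec (2 ^ n) j :: 'a vec)"
        by (intro eq_vecI) auto
      have "cd_mult \<gamma> n (- unit_vec (2 ^ n) j) (unit_vec (2 ^ n) j) = (- a) \<cdot>\<^sub>v unit_vec (2 ^ n) 0"
      proof -
        have "cd_mult \<gamma> n (- unit_vec (2 ^ n) j) (unit_vec (2 ^ n) j) =
            0\<^sub>v (2 ^ n) + (- 1) \<cdot>\<^sub>v (a \<cdot>\<^sub>v unit_vec (2 ^ n) 0)"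
          unfolding neg using cd_mult_lin[of "0\<^sub>v (2 ^ n)" n "unit_vec (2 ^ n) j" "unit_vec (2 ^ n) j" \<gamma> "- 1"]
          by (simp only: zero_carrier_vec unit_vec_carrier cd_mult_zero a)
        also have "\<dots> = (- a) \<cdot>\<^sub>v unit_vec (2 ^ n) 0" by (intro eq_vecI) auto
        finally show ?thesis .
      qed
      then have "\<exists>b. cd_mult \<gamma> n (cd_conj n (unit_vec (2 ^ n) j)) (unit_vec (2 ^ n) j) =
          b \<cdot>\<^sub>v unit_vec (2 ^ n) 0"
        unfolding cd_conj_basis[OF j] using a by (cases "j = 0") auto
      then obtain b where "cd_mult \<gamma> n (cd_conj n (unit_vec (2 ^ n) j)) (unit_vec (2 ^ n) j) =
          b \<cdot>\<^sub>v unit_vec (2 ^ n) 0" by blast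
      then show ?thesis unfolding ij basis_split(2)[OF j] basis_split(1)[OF z] sm
        by (intro exI[of _ "\<gamma> (Suc n) * b"])
          (simp add: split_append Let_def cd_zero cd_conj_carrier smult_smult_assoc)
    qed
  qed
  then show ?thesis by (auto simp: cd_alpha_def)
qed

lemma monomial_eval_carrier:
  "set_gen_monomial T \<subseteq> carrier_vec (2 ^ n) \<Longrightarrow> x \<in> carrier_vec (2 ^ n) \<Longrightarrow>
    monomial_eval \<gamma> n T x \<in> carrier_vec (2 ^ n)"
  by (induction T) (auto simp: cd_mult_carrier)

lemma monomial_eval_const: "num_vars T = 0 \<Longrightarrow> monomial_eval \<gamma> n T x = monomial_eval \<gamma> n T y"
  by (induction T) auto

lemma monomial_eval_lin:
  assumes "linear_term n T" "x \<in> carrier_vec (2 ^ n)" "y \<in> carrier_vec (2 ^ n)"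
  shows "monomial_eval \<gamma> n T (x + c \<cdot>\<^sub>v y) = monomial_eval \<gamma> n T x + c \<cdot>\<^sub>v monomial_eval \<gamma> n T y"
  using assms(1)
proof (induction T)
  case (Prod S T)
  have set: "set_gen_monomial S \<subseteq> carrier_vec (2 ^ n)" "set_gen_monomial T \<subseteq> carrier_vec (2 ^ n)"
    and num: "num_vars S + num_vars T = 1"
    using Prod.prems by (auto simp: linear_term_def)
  note carr = monomial_eval_carrier[OF set(1)] monomial_eval_carrier[OF set(2)]
  consider "num_vars S = 1" "num_vars T = 0" | "num_vars S = 0" "num_vars T = 1"
    using num by linarith
  then show ?case
  proof cases
    case 1
    then have "linear_term n S" using set by (simp add: linear_term_def)
    moreover have "monomial_eval \<gamma> n T (x + c \<cdot>\<^sub>v y) = monomial_eval \<gamma> n T x"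
      "monomial_eval \<gamma> n T y = monomial_eval \<gamma> n T x"
      using monomial_eval_const[OF 1(2)] by blast+
    ultimately show ?thesis
      using Prod.IH(1) carr assms(2,3) by (simp add: cd_mult_lin)
  next
    case 2
    then have "linear_term n T" using set by (simp add: linear_term_def)
    moreover have "monomial_eval \<gamma> n S (x + c \<cdot>\<^sub>v y) = monomial_eval \<gamma> n S x"
      "monomial_eval \<gamma> n S y = monomial_eval \<gamma> n S x"
      using monomial_eval_const[OF 2(1)] by blast+
    ultimately show ?thesis
      using Prod.IH(2) carr assms(2,3) by (simp add: cd_mult_lin)
  qed
qed (auto simp: linear_term_def)

lemma linear_part_carrier:
  "\<forall>T \<in> set Ts. linear_term n T \<Longrightarrow> x \<in> carrier_vec (2 ^ n) \<Longrightarrow>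
    linear_part \<gamma> n Ts x \<in> carrier_vec (2 ^ n)"
  by (induction Ts) (auto simp: linear_part_def linear_term_def monomial_eval_carrier)

lemma linear_part_lin:
  assumes "\<forall>T \<in> set Ts. linear_term n T" "x \<in> carrier_vec (2 ^ n)" "y \<in> carrier_vec (2 ^ n)"
  shows "linear_part \<gamma> n Ts (x + c \<cdot>\<^sub>v y) = linear_part \<gamma> n Ts x + c \<cdot>\<^sub>v linear_part \<gamma> n Ts y"
  using assms(1)
proof (induction Ts)
  case Nil
  then show ?case by (auto simp: linear_part_def)
next
  case (Cons T Ts)
  have step: "linear_part \<gamma> n (T # Ts) z = monomial_eval \<gamma> n T z + linear_part \<gamma> n Ts z" for z
    by (simp add: linear_part_def)
  have T: "linear_term n T" and Ts: "\<forall>T \<in> set Ts. linear_term n T" using Cons.prems by auto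
  have "monomial_eval \<gamma> n T z \<in> carrier_vec (2 ^ n) \<and> linear_part \<gamma> n Ts z \<in> carrier_vec (2 ^ n)"
    if "z \<in> carrier_vec (2 ^ n)" for z
    using that T Ts by (auto simp: linear_term_def monomial_eval_carrier linear_part_carrier)
  note carr = this[OF assms(2)] this[OF assms(3)]
  show ?case
    unfolding step Cons.IH[OF Ts] monomial_eval_lin[OF T assms(2,3)]
    using carr by (auto intro!: eq_vecI simp: algebra_simps)
qed

lemma linear_part_eq:
  assumes Ts: "\<forall>T \<in> set Ts. linear_term n T" and x: "x \<in> carrier_vec (2 ^ n)" and i: "i < 2 ^ n"
  shows "linear_part \<gamma> n Ts x $ i = linear_form \<gamma> n Ts i x"
proof -
  define p where "p N = vec (2 ^ n) (\<lambda>j. if j < N then x $ j else 0)" for N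
  have p: "p N \<in> carrier_vec (2 ^ n)" for N by (simp add: p_def)
  have px: "p (2 ^ n) = x" using x by (intro eq_vecI) (auto simp: p_def)
  have zero: "linear_part \<gamma> n Ts (0\<^sub>v (2 ^ n)) = 0\<^sub>v (2 ^ n)"
  proof -
    let ?z = "linear_part \<gamma> n Ts (0\<^sub>v (2 ^ n))"
    have z: "?z \<in> carrier_vec (2 ^ n)" using linear_part_carrier[OF Ts] by auto
    have "0\<^sub>v (2 ^ n) + (- 1) \<cdot>\<^sub>v 0\<^sub>v (2 ^ n) = (0\<^sub>v (2 ^ n) :: 'a vec)" by auto
    then have "?z = ?z + (- 1) \<cdot>\<^sub>v ?z"
      using linear_part_lin[OF Ts, of "0\<^sub>v (2 ^ n)" "0\<^sub>v (2 ^ n)" \<gamma> "- 1"] by simp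
    also have "\<dots> = 0\<^sub>v (2 ^ n)" using z by (auto intro!: eq_vecI)
    finally show ?thesis .
  qed
  have "linear_part \<gamma> n Ts (p N) $ i = (\<Sum>k<N. linear_coeff \<gamma> n Ts i k * x $ k)" if "N \<le> 2 ^ n" for N
    using that
  proof (induction N)
    case 0
    have "p 0 = 0\<^sub>v (2 ^ n)" by (auto simp: p_def)
    then show ?case using zero i by simp
  next
    case (Suc N)
    have "p (Suc N) = p N + x $ N \<cdot>\<^sub>v unit_vec (2 ^ n) N"
      using Suc.prems by (intro eq_vecI) (auto simp: p_def less_Suc_eq)
    then show ?case
      using Suc linear_part_lin[OF Ts p[of N], of "unit_vec (2 ^ n) N" \<gamma> "x $ N"] i
        linear_part_carrier[OF Ts, of "unit_vec (2 ^ n) N" \<gamma>] linear_part_carrier[OF Ts p[of N], of \<gamma>]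
      by (simp add: linear_coeff_def)
  qed
  from this[of "2 ^ n"] show ?thesis using px by (simp add: linear_form_def)
qed

end

theory Submission
  imports Defs "Jordan_Normal_Form.Char_Poly" "Jordan_Normal_Form.Matrix_Kernel"
begin

text \<open>
  Since distinct imaginary basis elements anticommute, \<open>x\<^sup>2\<close> has real part
  \<open>t\<^sup>2 + \<Sum> \<alpha>\<^sub>i x\<^sub>i\<^sup>2\<close> and imaginary coordinates \<open>2 t x\<^sub>i\<close>. So \<open>x\<close> is a root iff it lies on
  the quadric and its imaginary part \<open>v\<close> solves a linear system \<open>(t - A) v = b(t)\<close>, where \<open>b\<close>
  is affine in \<open>t\<close>. Multiplying with the adjugate gives \<open>\<chi>(t) v = w(t)\<close>, where \<open>\<chi>\<close> is
  the characteristic polynomial of \<open>A\<close> and the entries of \<open>w\<close> have degree at most \<open>m\<close>.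
  Hence \<open>\<chi>\<^sup>2\<close> times the quadratic form is a polynomial in \<open>t\<close> alone, of degree exactly
  \<open>2 m + 2\<close>, which vanishes at the real part of every root, whether or not \<open>\<chi>(t) = 0\<close>. If two
  roots share the same \<open>t\<close>, then \<open>\<chi>(t) = 0\<close>, which happens for at most \<open>m\<close> values; for
  each of them the linear system cuts out an affine subspace.
\<close>

section \<open>Squares in coordinates\<close>

lemma cd_conj_eq:
  assumes "x \<in> carrier_vec (2 ^ n)"
  shows "cd_conj n x = vec (2 ^ n) (\<lambda>i. if i = 0 then x $ 0 else - x $ i)"
  using assms
proof (induction n arbitrary: x)
  case (Suc n)
  then show ?case
    by (auto intro!: eq_vecI simp: append_vec_def Let_def vec_first_def vec_last_def)
qed (auto intro!: eq_vecI)

lemma cd_mult_append_index_0: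
  assumes "a \<in> carrier_vec (2 ^ n)" "b \<in> carrier_vec (2 ^ n)"
    "c \<in> carrier_vec (2 ^ n)" "d \<in> carrier_vec (2 ^ n)"
  shows "cd_mult \<gamma> (Suc n) (a @\<^sub>v b) (c @\<^sub>v d) $ 0 =
    cd_mult \<gamma> n a c $ 0 + \<gamma> (Suc n) * cd_mult \<gamma> n (cd_conj n d) b $ 0"
  using carrier_vecD[OF cd_mult_carrier[OF assms(1,3), of \<gamma>]]
    carrier_vecD[OF cd_mult_carrier[OF cd_conj_carrier[OF assms(4)] assms(2), of \<gamma>]]
  by (simp add: Let_def split_append assms)

lemma cd_alpha_first:
  assumes "i < 2 ^ n"
  shows "cd_alpha \<gamma> (Suc n) i = cd_alpha \<gamma> n i"
  unfolding cd_alpha_def basis_split(1)[OF assms]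
  by (subst cd_mult_append_index_0) (auto simp: cd_zero)

text \<open>The doubling formula gives (e_j l)^2 = \<gamma> conj(e_j) e_j for the new generator l.
  Conjugation fixes e_0 and negates every other basis element, whence the two cases.\<close>

lemma cd_alpha_last:
  assumes "j < 2 ^ n"
  shows "cd_alpha \<gamma> (Suc n) (2 ^ n + j) = (if j = 0 then \<gamma> (Suc n) else - \<gamma> (Suc n) * cd_alpha \<gamma> n j)"
proof -
  let ?e = "unit_vec (2 ^ n) j :: 'a vec"
  have "cd_alpha \<gamma> (Suc n) (2 ^ n + j) = \<gamma> (Suc n) * cd_mult \<gamma> n (cd_conj n ?e) ?e $ 0"
    unfolding cd_alpha_def basis_split(2)[OF assms]
    by (subst cd_mult_append_index_0) (auto simp: cd_zero)
  also have "cd_mult \<gamma> n (cd_conj n ?e) ?e $ 0 = (if j = 0 then 1 else - cd_alpha \<gamma> n j)"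
  proof (cases "j = 0")
    case True
    then show ?thesis using cd_mult_one[of ?e n \<gamma>] assms by (simp add: cd_conj_basis)
  next
    case False
    \<comment> \<open>Negation is rewritten as u + c v, the shape to which
      \<open>cd_mult_lin\<close> applies.\<close>
    have neg: "- ?e = 0\<^sub>v (2 ^ n) + (- 1) \<cdot>\<^sub>v ?e" by (intro eq_vecI) auto
    have "cd_mult \<gamma> n (- ?e) ?e = 0\<^sub>v (2 ^ n) + (- 1) \<cdot>\<^sub>v cd_mult \<gamma> n ?e ?e"
      unfolding neg using cd_mult_lin[of "0\<^sub>v (2 ^ n)" n ?e ?e \<gamma> "- 1"] by (simp add: cd_mult_zero)
    then show ?thesis
      using False assms carrier_vecD[OF cd_mult_carrier[of ?e n ?e \<gamma>]]
      by (simp add: cd_conj_basis cd_alpha_def)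
  qed
  finally show ?thesis by simp
qed

text \<open>The range splits at \<open>2 ^ n\<close>, the index of the new generator, whose square
  is \<open>\<gamma> (Suc n)\<close>. The bracket is the norm form of the second half of the
  coordinates.\<close>

lemma sum_cd_alpha_Suc:
  fixes x :: "nat \<Rightarrow> 'a :: field"
  shows "(\<Sum>i = 1..2 ^ Suc n - 1. cd_alpha \<gamma> (Suc n) i * (x i)\<^sup>2) =
    (\<Sum>i = 1..2 ^ n - 1. cd_alpha \<gamma> n i * (x i)\<^sup>2)
    + \<gamma> (Suc n) * ((x (2 ^ n))\<^sup>2 - (\<Sum>i = 1..2 ^ n - 1. cd_alpha \<gamma> n i * (x (2 ^ n + i))\<^sup>2))"
proof -
  let ?N = "2 ^ n :: nat"
  have N: "?N \<ge> 1" by simp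
  have iv: "{1..k - 1} = {1..<k}" if "k \<ge> 1" for k :: nat using that by auto
  have iv2: "{1..2 ^ Suc n - 1} = {1..<?N + ?N}"
    using iv[of "?N + ?N"] N by (simp add: mult_2 del: One_nat_def)
  let ?f = "\<lambda>i. cd_alpha \<gamma> (Suc n) i * (x i)\<^sup>2"
  have "sum ?f {1..2 ^ Suc n - 1} = sum ?f {1..<?N} + sum ?f {?N..<?N + ?N}"
    unfolding iv2 using N by (simp add: sum.atLeastLessThan_concat)
  also have "sum ?f {1..<?N} = (\<Sum>i = 1..<?N. cd_alpha \<gamma> n i * (x i)\<^sup>2)"
    by (intro sum.cong) (auto simp: cd_alpha_first)
  also have "sum ?f {?N..<?N + ?N} = (\<Sum>j = 0..<?N. ?f (?N + j))"
    using sum.shift_bounds_nat_ivl[of ?f 0 ?N ?N] by (simp add: add.commute)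
  also have "\<dots> = ?f (?N + 0) + (\<Sum>j = 1..<?N. ?f (?N + j))"
    using N by (simp add: sum.atLeast_Suc_lessThan)
  also have "(\<Sum>j = 1..<?N. ?f (?N + j))
      = - \<gamma> (Suc n) * (\<Sum>i = 1..<?N. cd_alpha \<gamma> n i * (x (?N + i))\<^sup>2)"
    unfolding sum_distrib_left by (intro sum.cong) (auto simp: cd_alpha_last)
  also have "?f (?N + 0) = \<gamma> (Suc n) * (x ?N)\<^sup>2"
    by (subst cd_alpha_last) auto
  finally show ?thesis unfolding iv[OF N] by (simp add: algebra_simps)
qed

text \<open>Doubling gives (q + s l)^2 = q^2 + \<gamma> conj(s) s + (s q + s conj(q)) l. Since
  conj(y) = 2 y_0 - y, the last bracket is 2 q_0 s and conj(s) s = 2 s_0 s - s^2, so the squares of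
  q and s from the induction hypothesis suffice.\<close>

lemma cd_mult_self:
  assumes "x \<in> carrier_vec (2 ^ n)"
  shows "cd_mult \<gamma> n x x = vec (2 ^ n) (\<lambda>i. if i = 0
    then (x $ 0)\<^sup>2 + (\<Sum>i = 1..2 ^ n - 1. cd_alpha \<gamma> n i * (x $ i)\<^sup>2) else 2 * x $ 0 * x $ i)"
  using assms
proof (induction n arbitrary: x)
  case 0
  then show ?case by (auto intro!: eq_vecI simp: power2_eq_square)
next
  case (Suc n)
  let ?N = "2 ^ n :: nat"
  define q where "q = vec_first x ?N"
  define s where "s = vec_last x ?N"
  define e where "e = (unit_vec ?N 0 :: 'a vec)"
  have dim: "q \<in> carrier_vec ?N" "s \<in> carrier_vec ?N" "e \<in> carrier_vec ?N"
    by (auto simp: q_def s_def e_def)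
  have qi: "q $ i = x $ i" and si: "s $ i = x $ (?N + i)" if "i < ?N" for i
    using that Suc.prems by (auto simp: q_def s_def vec_first_def vec_last_def)
  have conj: "cd_conj n y = - y + (2 * y $ 0) \<cdot>\<^sub>v e" if "y \<in> carrier_vec ?N" for y :: "'a vec"
    unfolding cd_conj_eq[OF that] using that by (intro eq_vecI) (auto simp: e_def)
  have neg: "- y = 0\<^sub>v ?N + (- 1) \<cdot>\<^sub>v y" if "y \<in> carrier_vec ?N" for y :: "'a vec"
    using that by (intro eq_vecI) auto
  have mult_neg: "cd_mult \<gamma> n (- y) z = - cd_mult \<gamma> n y z" "cd_mult \<gamma> n z (- y) = - cd_mult \<gamma> n z y"
    if "y \<in> carrier_vec ?N" "z \<in> carrier_vec ?N" for y z
    using cd_mult_lin[of "0\<^sub>v ?N" n y z \<gamma> "- 1"] that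
    unfolding neg[OF that(1)] neg[OF cd_mult_carrier[OF that]] neg[OF cd_mult_carrier[OF that(2,1)]]
    by (simp_all only: cd_mult_zero zero_carrier_vec)
  have ss: "cd_mult \<gamma> n (cd_conj n s) s = - cd_mult \<gamma> n s s + (2 * s $ 0) \<cdot>\<^sub>v s"
    unfolding conj[OF dim(2)]
    using cd_mult_lin[of "- s" n e s \<gamma> "2 * s $ 0"] dim cd_mult_one[of s n \<gamma>]
    by (simp add: mult_neg e_def)
  have sq: "cd_mult \<gamma> n s (cd_conj n q) = - cd_mult \<gamma> n s q + (2 * q $ 0) \<cdot>\<^sub>v s"
    unfolding conj[OF dim(1)]
    using cd_mult_lin[of "- q" n e s \<gamma> "2 * q $ 0"] dim cd_mult_one[of s n \<gamma>]
    by (simp add: mult_neg e_def)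
  let ?A = "cd_mult \<gamma> n q q + \<gamma> (Suc n) \<cdot>\<^sub>v cd_mult \<gamma> n (cd_conj n s) s"
  let ?B = "cd_mult \<gamma> n s q + cd_mult \<gamma> n s (cd_conj n q)"
  have prod: "cd_mult \<gamma> (Suc n) x x = ?A @\<^sub>v ?B" by (simp add: Let_def q_def s_def)
  have B: "?B = (2 * q $ 0) \<cdot>\<^sub>v s"
    unfolding sq using dim cd_mult_carrier[of s n q \<gamma>] by (intro eq_vecI) auto
  have sums: "(\<Sum>i = 1..2 ^ n - 1. cd_alpha \<gamma> n i * (q $ i)\<^sup>2) = (\<Sum>i = 1..2 ^ n - 1. cd_alpha \<gamma> n i * (x $ i)\<^sup>2)"
    "(\<Sum>i = 1..2 ^ n - 1. cd_alpha \<gamma> n i * (s $ i)\<^sup>2) = (\<Sum>i = 1..2 ^ n - 1. cd_alpha \<gamma> n i * (x $ (?N + i))\<^sup>2)"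
  proof -
    have *: "i < ?N" if "i \<in> {1..2 ^ n - 1}" for i
      using that zero_less_power[of "2 :: nat" n] unfolding atLeastAtMost_iff by arith
    show "(\<Sum>i = 1..2 ^ n - 1. cd_alpha \<gamma> n i * (q $ i)\<^sup>2) = (\<Sum>i = 1..2 ^ n - 1. cd_alpha \<gamma> n i * (x $ i)\<^sup>2)"
      "(\<Sum>i = 1..2 ^ n - 1. cd_alpha \<gamma> n i * (s $ i)\<^sup>2) = (\<Sum>i = 1..2 ^ n - 1. cd_alpha \<gamma> n i * (x $ (?N + i))\<^sup>2)"
      using * by (auto intro!: sum.cong simp: qi si)
  qed
  \<comment> \<open>Coordinate 0 of 2 s_0 s - s^2 is s_0^2 minus the weighted squares of the other
    s_i, which is the bracket of \<open>sum_cd_alpha_Suc\<close>.\<close>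
  have A0: "?A $ 0 = (x $ 0)\<^sup>2 + (\<Sum>i = 1..2 ^ Suc n - 1. cd_alpha \<gamma> (Suc n) i * (x $ i)\<^sup>2)"
    unfolding ss Suc.IH[OF dim(1)] Suc.IH[OF dim(2)] sum_cd_alpha_Suc sums
    using dim by (simp add: qi si) (simp add: algebra_simps power2_eq_square)
  \<comment> \<open>By the induction hypothesis s^2 has imaginary coordinates 2 s_0 s_i, which 2 s_0
    s cancels; only q^2 contributes.\<close>
  have A: "?A $ i = 2 * x $ 0 * x $ i" if "i < ?N" "i \<noteq> 0" for i
    unfolding ss Suc.IH[OF dim(1)] Suc.IH[OF dim(2)] using that dim by (simp add: qi si)
  have Ac: "?A \<in> carrier_vec ?N" using dim by (simp add: cd_mult_carrier cd_conj_carrier)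
  show ?case
  proof (rule eq_vecI)
    fix i assume "i < dim_vec (vec (2 ^ Suc n) (\<lambda>i. if i = 0
      then (x $ 0)\<^sup>2 + (\<Sum>i = 1..2 ^ Suc n - 1. cd_alpha \<gamma> (Suc n) i * (x $ i)\<^sup>2) else 2 * x $ 0 * x $ i))"
    then have i: "i < 2 ^ Suc n" by simp
    have Ad: "dim_vec ?A = ?N" using Ac by (rule carrier_vecD)
    have sd: "dim_vec s = ?N" using dim by auto
    have "(?A @\<^sub>v ?B) $ i = (if i = 0
      then (x $ 0)\<^sup>2 + (\<Sum>i = 1..2 ^ Suc n - 1. cd_alpha \<gamma> (Suc n) i * (x $ i)\<^sup>2) else 2 * x $ 0 * x $ i)"
    proof (cases "i < ?N")
      case True
      then have "(?A @\<^sub>v ?B) $ i = ?A $ i" using Ad i sd unfolding B by (subst index_append_vec) auto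
      then show ?thesis using A0 A[OF True] by auto
    next
      case False
      then have "(?A @\<^sub>v ?B) $ i = ((2 * q $ 0) \<cdot>\<^sub>v s) $ (i - ?N)"
        using Ad i sd unfolding B by (subst index_append_vec) auto
      then show ?thesis using False i sd by (auto simp: qi si)
    qed
    then show "cd_mult \<gamma> (Suc n) x x $ i = vec (2 ^ Suc n) (\<lambda>i. if i = 0
      then (x $ 0)\<^sup>2 + (\<Sum>i = 1..2 ^ Suc n - 1. cd_alpha \<gamma> (Suc n) i * (x $ i)\<^sup>2) else 2 * x $ 0 * x $ i) $ i"
      unfolding prod using i by simp
  next
    show "dim_vec (cd_mult \<gamma> (Suc n) x x) = dim_vec (vec (2 ^ Suc n) (\<lambda>i. if i = 0
      then (x $ 0)\<^sup>2 + (\<Sum>i = 1..2 ^ Suc n - 1. cd_alpha \<gamma> (Suc n) i * (x $ i)\<^sup>2) else 2 * x $ 0 * x $ i))"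
      using carrier_vecD[OF cd_mult_carrier[OF Suc.prems Suc.prems]] by simp
  qed
qed

section \<open>Elimination over the polynomial ring\<close>

text \<open>Cramer's rule for xI - A over the polynomial ring, evaluated at t. No division occurs,
  so the conclusion also holds at zeros of the characteristic polynomial.\<close>

lemma linear_system_elimination:
  fixes A :: "'a :: field mat" and b :: "nat \<Rightarrow> 'a poly"
  assumes A: "A \<in> carrier_mat m m" and b: "\<forall>i<m. degree (b i) \<le> 1"
  obtains w where "\<forall>j<m. degree (w j) \<le> m"
    and "\<And>t v. \<forall>i<m. t * v i - (\<Sum>k<m. A $$ (i, k) * v k) = poly (b i) t \<Longrightarrow>
      \<forall>j<m. poly (char_poly A) t * v j = poly (w j) t"
proof
  define P where "P = char_poly_matrix A"
  have P: "P \<in> carrier_mat m m" using A by (simp add: P_def)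
  note adj = adj_mat[OF P]
  define w where "w j = (\<Sum>i<m. adj_mat P $$ (j, i) * b i)" for j
  have Pij: "P $$ (i, j) = (if i = j then [:- A $$ (i, j), 1:] else [:- A $$ (i, j):])"
    if "i < m" "j < m" for i j
    using that A by (simp add: P_def char_poly_matrix_def)
  \<comment> \<open>The entries are signed minors of order m - 1 of a matrix whose entries have
    degree at most 1.\<close>
  have deg_adj: "degree (adj_mat P $$ (j, i)) \<le> m - 1" if "i < m" "j < m" for i j
  proof -
    have "degree (det (mat_delete P i j)) \<le> 1 * (m - 1)"
    proof (rule degree_det_le)
      show "mat_delete P i j \<in> carrier_mat (m - 1) (m - 1)"
        using P by (auto simp: mat_delete_def)
      fix i' j' assume ij: "i' < m - 1" "j' < m - 1"
      then have "mat_delete P i j $$ (i', j') =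
          P $$ (if i' < i then i' else Suc i', if j' < j then j' else Suc j')"
        using P by (simp add: mat_delete_def)
      then show "degree (mat_delete P i j $$ (i', j')) \<le> 1"
        using ij by (simp add: Pij)
    qed
    moreover have "adj_mat P $$ (j, i) = (- 1) ^ (i + j) * det (mat_delete P i j)"
      using that P by (simp add: adj_mat_def cofactor_def)
    moreover have "degree ((- 1) ^ k * p) = degree p" for k and p :: "'a poly"
      by (cases "even k") auto
    ultimately show ?thesis by simp
  qed
  have "degree (w j) \<le> m" if "j < m" for j
    unfolding w_def
  proof (rule degree_sum_le)
    fix i assume "i \<in> {..<m}"
    then have "degree (adj_mat P $$ (j, i)) + degree (b i) \<le> (m - 1) + 1"
      using deg_adj[of i j] b that by (intro add_mono) auto
    \<comment> \<open>Here \<open>j < m\<close> forces m > 0, so (m - 1) + 1 = m despite truncated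
      subtraction.\<close>
    then show "degree (adj_mat P $$ (j, i) * b i) \<le> m"
      using degree_mult_le[of "adj_mat P $$ (j, i)" "b i"] that by linarith
  qed simp
  then show "\<forall>j<m. degree (w j) \<le> m" by blast
  fix t v
  assume sys: "\<forall>i<m. t * v i - (\<Sum>k<m. A $$ (i, k) * v k) = poly (b i) t"
  have row: "(\<Sum>k<m. poly (P $$ (i, k)) t * v k) = poly (b i) t" if "i < m" for i
  proof -
    have "(\<Sum>k<m. poly (P $$ (i, k)) t * v k) = (\<Sum>k<m. (if i = k then t * v k else 0) - A $$ (i, k) * v k)"
      using that by (intro sum.cong) (auto simp: Pij algebra_simps)
    also have "\<dots> = t * v i - (\<Sum>k<m. A $$ (i, k) * v k)"
      using that by (simp add: sum_subtractf)
    finally show ?thesis using sys that by simp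
  qed
  show "\<forall>j<m. poly (char_poly A) t * v j = poly (w j) t"
  proof (intro allI impI)
    fix j assume j: "j < m"
    have "poly (w j) t = (\<Sum>i<m. poly (adj_mat P $$ (j, i)) t * (\<Sum>k<m. poly (P $$ (i, k)) t * v k))"
      by (simp add: w_def poly_sum row)
    \<comment> \<open>Exchanging the sums exposes the product of the adjugate with \<open>P\<close>,
      which is \<open>det P\<close> times the identity.\<close>
    also have "\<dots> = (\<Sum>k<m. (\<Sum>i<m. poly (adj_mat P $$ (j, i)) t * poly (P $$ (i, k)) t) * v k)"
      by (simp add: sum_distrib_left sum_distrib_right mult.assoc) (rule sum.swap)
    also have "\<dots> = (\<Sum>k<m. poly ((adj_mat P * P) $$ (j, k)) t * v k)"
      using P adj(1) j
      by (intro sum.cong) (auto simp: scalar_prod_def poly_sum lessThan_atLeast0)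
    also have "\<dots> = (\<Sum>k<m. if j = k then poly (det P) t * v k else 0)"
      unfolding adj(3) using j by (intro sum.cong) auto
    also have "\<dots> = poly (char_poly A) t * v j"
      using j by (simp add: char_poly_def P_def)
    finally show "poly (char_poly A) t * v j = poly (w j) t" by simp
  qed
qed

text \<open>Multiplying the quadric equation by \<chi>^2 clears the denominators of v = w / \<chi>.
  The summand \<chi>^2 c has degree 2m + 2 and the others at most 2m, so the leading term survives
  and p is nonzero.\<close>

lemma quadric_elimination:
  fixes A :: "'a :: field mat" and b :: "nat \<Rightarrow> 'a poly" and \<alpha> h :: "nat \<Rightarrow> 'a" and c :: "'a poly"
  assumes A: "A \<in> carrier_mat m m" and b: "\<forall>i<m. degree (b i) \<le> 1"
    and c: "degree c = 2"
  obtains p where "p \<noteq> 0" "degree p \<le> 2 * m + 2"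
    and "\<And>t v. \<forall>i<m. t * v i - (\<Sum>k<m. A $$ (i, k) * v k) = poly (b i) t \<Longrightarrow>
      poly c t + (\<Sum>i<m. \<alpha> i * (v i)\<^sup>2) + (\<Sum>i<m. h i * v i) = 0 \<Longrightarrow> poly p t = 0"
proof -
  obtain w where w: "\<forall>j<m. degree (w j) \<le> m"
    and sol: "\<And>t v. \<forall>i<m. t * v i - (\<Sum>k<m. A $$ (i, k) * v k) = poly (b i) t \<Longrightarrow>
      \<forall>j<m. poly (char_poly A) t * v j = poly (w j) t"
    by (rule linear_system_elimination[OF A b]) blast
  define \<chi> where "\<chi> = char_poly A"
  have \<chi>: "degree \<chi> = m" "\<chi> \<noteq> 0" using degree_monic_char_poly[OF A] by (auto simp: \<chi>_def)
  \<comment> \<open>As w_i takes the value \<chi> v_i at t, this is \<chi>^2 times the part of the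
    equation that involves v. In the linear terms w_i absorbs one factor \<chi> and the other
    remains.\<close>
  define l where "l = (\<Sum>i<m. Polynomial.smult (\<alpha> i) ((w i)\<^sup>2)) + \<chi> * (\<Sum>i<m. Polynomial.smult (h i) (w i))"
  define p where "p = \<chi>\<^sup>2 * c + l"
  have c0: "c \<noteq> 0" using c by auto
  have lead: "degree (\<chi>\<^sup>2 * c) = 2 * m + 2"
    using \<chi> c c0 by (simp add: degree_mult_eq degree_power_eq)
  have low: "degree l \<le> 2 * m" unfolding l_def
  proof (intro degree_add_le degree_sum_le)
    fix i assume "i \<in> {..<m}"
    then show "degree (Polynomial.smult (\<alpha> i) ((w i)\<^sup>2)) \<le> 2 * m"
      using degree_power_le[of "w i" 2] w by (intro degree_smult_le[THEN order_trans]) auto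
  next
    have "degree (\<Sum>i<m. Polynomial.smult (h i) (w i)) \<le> m"
      using w by (intro degree_sum_le degree_smult_le[THEN order_trans]) auto
    then show "degree (\<chi> * (\<Sum>i<m. Polynomial.smult (h i) (w i))) \<le> 2 * m"
      using degree_mult_le[of \<chi> "\<Sum>i<m. Polynomial.smult (h i) (w i)"] \<chi> by linarith
  qed simp
  have deg: "degree p = 2 * m + 2"
    unfolding p_def using lead low by (subst degree_add_eq_left) auto
  show thesis
  proof
    show "p \<noteq> 0" "degree p \<le> 2 * m + 2" using deg by auto
    fix t v
    assume sys: "\<forall>i<m. t * v i - (\<Sum>k<m. A $$ (i, k) * v k) = poly (b i) t"
      and quad: "poly c t + (\<Sum>i<m. \<alpha> i * (v i)\<^sup>2) + (\<Sum>i<m. h i * v i) = 0"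
    have wv: "poly (w j) t = poly \<chi> t * v j" if "j < m" for j using sol[OF sys] that by (simp add: \<chi>_def)
    have "poly p t = (poly \<chi> t)\<^sup>2 * (poly c t + (\<Sum>i<m. \<alpha> i * (v i)\<^sup>2) + (\<Sum>i<m. h i * v i))"
      by (simp add: p_def l_def poly_sum wv algebra_simps power2_eq_square sum_distrib_left)
    then show "poly p t = 0" using quad by simp
  qed
qed

section \<open>Solution sets of linear systems\<close>

text \<open>A nonempty solution set is a coset of the kernel. The second solution puts the nonzero
  vector \<open>y - x\<close> into the kernel, which forces positive dimension.\<close>

lemma affine_subspace_solutions:
  fixes B :: "'a :: field mat"
  assumes B: "B \<in> carrier_mat k N" and x: "x \<in> carrier_vec N" and y: "y \<in> carrier_vec N"
    and eq: "B *\<^sub>v y = B *\<^sub>v x" and ne: "x \<noteq> y"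
  shows "\<exists>d > 0. affine_subspace N d {z \<in> carrier_vec N. B *\<^sub>v z = B *\<^sub>v x}"
proof -
  interpret kernel k N B by unfold_locales (rule B)
  obtain S where S: "finite S" "basis S" using kernel_basis_exists[OF B] by blast
  have mem: "y - x \<in> mat_kernel B"
    using B x y eq by (intro mat_kernelI[OF B]) (auto simp: mult_minus_distrib_mat_vec)
  have "dim > 0"
  proof (rule ccontr)
    assume "\<not> dim > 0"
    then have "S = {}" using Ker.dim_basis[OF S] S(1) by simp
    then have "mat_kernel B = {0\<^sub>v N}"
      using S(2) by (simp add: Ker.basis_def Ker.span_def Ker.lincomb_def)
    then have "y - x = 0\<^sub>v N" using mem by simp
    then show False using ne x y
      by (metis eq_vecI carrier_vecD index_minus_vec(1) index_zero_vec(1) right_minus_eq)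
  qed
  moreover have "VectorSpace.subspace class_ring (mat_kernel B) (module_vec TYPE('a) N)"
    unfolding VectorSpace.subspace_def
    using NC.vectorspace_axioms mult_add_distrib_mat_vec[OF B] mult_mat_vec[OF B] NC.module_axioms
    using B by (auto simp: submodule_def mat_kernel[OF B] module_vec_simps)
  moreover have "{z \<in> carrier_vec N. B *\<^sub>v z = B *\<^sub>v x} = (\<lambda>w. x + w) ` mat_kernel B"
  proof (intro equalityI subsetI)
    fix z assume "z \<in> {z \<in> carrier_vec N. B *\<^sub>v z = B *\<^sub>v x}"
    then have z: "z \<in> carrier_vec N" "B *\<^sub>v z = B *\<^sub>v x" by auto
    have "z - x \<in> mat_kernel B"
      using B x z by (intro mat_kernelI[OF B]) (auto simp: mult_minus_distrib_mat_vec)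
    moreover have "z = x + (z - x)" using x z by (intro eq_vecI) auto
    ultimately show "z \<in> (\<lambda>w. x + w) ` mat_kernel B" by blast
  next
    fix z assume "z \<in> (\<lambda>w. x + w) ` mat_kernel B"
    then obtain w where w: "z = x + w" "w \<in> mat_kernel B" by blast
    then show "z \<in> {z \<in> carrier_vec N. B *\<^sub>v z = B *\<^sub>v x}"
      using mat_kernelD[OF B w(2)] B x by (auto simp: mult_add_distrib_mat_vec)
  qed
  ultimately show ?thesis using x by (auto simp: affine_subspace_def intro!: exI[of _ dim] bexI[of _ x] exI[of _ "mat_kernel B"])
qed

section \<open>The equations of a root\<close>

lemma all_less_iff_0:
  fixes N :: nat
  assumes "0 < N"
  shows "(\<forall>i<N. P i) \<longleftrightarrow> P 0 \<and> (\<forall>i \<in> {1..<N}. P i)"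
proof -
  have "{..<N} = insert 0 {1..<N}" using assms by auto
  then show ?thesis by (metis (no_types, lifting) insert_iff lessThan_iff)
qed

text \<open>By \<open>cd_mult_self\<close>, coordinate 0 of f(x) yields the quadric, while the
  imaginary coordinates become affine linear in x once \<open>x $ 0\<close> is fixed.\<close>

lemma root_iff:
  assumes Ts: "\<forall>T \<in> set Ts. linear_term n T" and r: "r \<in> carrier_vec (2 ^ n)"
  shows "x \<in> roots \<gamma> n Ts r \<longleftrightarrow> x \<in> quadric \<gamma> n Ts r \<and>
    (\<forall>i \<in> {1..<2 ^ n}. 2 * x $ 0 * x $ i + linear_form \<gamma> n Ts i x + r $ i = 0)"
proof (cases "x \<in> carrier_vec (2 ^ n)")
  case True
  let ?f = "monic_quadratic_eval \<gamma> n Ts r x"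
  have "?f \<in> carrier_vec (2 ^ n)"
    using True r by (auto simp: monic_quadratic_eval_def cd_mult_carrier linear_part_carrier[OF Ts])
  then have "?f = 0\<^sub>v (2 ^ n) \<longleftrightarrow> (\<forall>i<2 ^ n. ?f $ i = 0)"
    by (auto intro!: eq_vecI)
  also have "\<dots> \<longleftrightarrow> ?f $ 0 = 0 \<and> (\<forall>i \<in> {1..<2 ^ n}. ?f $ i = 0)"
    by (rule all_less_iff_0) simp
  finally show ?thesis
    using True r carrier_vecD[OF linear_part_carrier[OF Ts True, of \<gamma>]]
    by (auto simp: roots_def quadric_def monic_quadratic_eval_def cd_mult_self linear_part_eq[OF Ts True])
qed (simp add: roots_def quadric_def)

text \<open>The polynomial \<open>p\<close> comes from \<open>quadric_elimination\<close>, and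
  \<open>q\<close> is the characteristic polynomial: elimination gives \<chi>(t) v_j the same value
  for all roots with real part t, so \<chi>(t) = 0 if two of them differ. The degrees supply the
  bounds 2m + 2 and m.\<close>

lemma roots_first_coordinate:
  fixes \<gamma> :: "nat \<Rightarrow> 'a :: field"
  assumes two: "(2 :: 'a) \<noteq> 0" and m: "m = 2 ^ n - 1"
    and Ts: "\<forall>T \<in> set Ts. linear_term n T" and r: "r \<in> carrier_vec (2 ^ n)"
  obtains p q where "p \<noteq> 0" "degree p \<le> 2 * m + 2" "q \<noteq> 0" "degree q \<le> m"
    and "\<And>x. x \<in> roots \<gamma> n Ts r \<Longrightarrow> poly p (x $ 0) = 0"
    and "\<And>x y. x \<in> roots \<gamma> n Ts r \<Longrightarrow> y \<in> roots \<gamma> n Ts r \<Longrightarrow> x $ 0 = y $ 0 \<Longrightarrow> x \<noteq> y \<Longrightarrow>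
      poly q (x $ 0) = 0"
proof -
  let ?g = "linear_coeff \<gamma> n Ts"
  have N: "2 ^ n = Suc m" using m by simp
  \<comment> \<open>Halving the imaginary equations isolates t v_i, so the coefficient matrix
    becomes t - A and the right-hand side b(t). Index i stands for the imaginary coordinate i +
    1.\<close>
  define A where "A = mat m m (\<lambda>(i, k). - ?g (Suc i) (Suc k) / 2)"
  define b where "b i = [:- r $ Suc i / 2, - ?g (Suc i) 0 / 2:]" for i
  \<comment> \<open>The terms of the quadric equation free of imaginary coordinates; t^2 makes the
    degree exactly 2.\<close>
  define c where "c = [:r $ 0, ?g 0 0, 1:]"
  have A: "A \<in> carrier_mat m m" by (simp add: A_def)
  have b: "\<forall>i<m. degree (b i) \<le> 1" by (simp add: b_def)
  have c: "degree c = 2" by (simp add: c_def)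
  have form: "linear_form \<gamma> n Ts i x = ?g i 0 * x $ 0 + (\<Sum>k<m. ?g i (Suc k) * x $ Suc k)" for i x
    unfolding linear_form_def N by (rule sum.lessThan_Suc_shift)
  have sys: "\<forall>i<m. x $ 0 * x $ Suc i - (\<Sum>k<m. A $$ (i, k) * x $ Suc k) = poly (b i) (x $ 0)"
    if x: "x \<in> roots \<gamma> n Ts r" for x
  proof (intro allI impI)
    fix i assume i: "i < m"
    have "2 * x $ 0 * x $ Suc i + linear_form \<gamma> n Ts (Suc i) x + r $ Suc i = 0"
      using x i root_iff[OF Ts r] N by auto
    moreover have "(\<Sum>k<m. A $$ (i, k) * x $ Suc k) = - (\<Sum>k<m. ?g (Suc i) (Suc k) * x $ Suc k) / 2"
      unfolding sum_negf[symmetric] sum_divide_distrib using i by (intro sum.cong) (auto simp: A_def)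
    moreover from calculation(1) have "2 * (x $ 0 * x $ Suc i) = - (linear_form \<gamma> n Ts (Suc i) x + r $ Suc i)"
      by (simp add: eq_neg_iff_add_eq_0 algebra_simps)
    \<comment> \<open>Characteristic different from 2 enters here.\<close>
    then have "x $ 0 * x $ Suc i = - (linear_form \<gamma> n Ts (Suc i) x + r $ Suc i) / 2"
      using two by (simp add: nonzero_eq_divide_eq mult.commute)
    ultimately show "x $ 0 * x $ Suc i - (\<Sum>k<m. A $$ (i, k) * x $ Suc k) = poly (b i) (x $ 0)"
      unfolding form by (simp add: b_def add_divide_distrib diff_divide_distrib)
  qed
  have quad: "poly c (x $ 0) + (\<Sum>i<m. cd_alpha \<gamma> n (Suc i) * (x $ Suc i)\<^sup>2)
      + (\<Sum>i<m. ?g 0 (Suc i) * x $ Suc i) = 0" if x: "x \<in> roots \<gamma> n Ts r" for x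
  proof -
    have "(\<Sum>i = 1..2 ^ n - 1. cd_alpha \<gamma> n i * (x $ i)\<^sup>2) = (\<Sum>i<m. cd_alpha \<gamma> n (Suc i) * (x $ Suc i)\<^sup>2)"
      unfolding m[symmetric] by (simp add: sum.atLeast1_atMost_eq)
    moreover have "(x $ 0)\<^sup>2 + (\<Sum>i = 1..2 ^ n - 1. cd_alpha \<gamma> n i * (x $ i)\<^sup>2)
        + linear_form \<gamma> n Ts 0 x + r $ 0 = 0"
      using x root_iff[OF Ts r] unfolding quadric_def by blast
    ultimately show ?thesis
      unfolding form by (simp add: c_def power2_eq_square algebra_simps)
  qed
  obtain p where p: "p \<noteq> 0" "degree p \<le> 2 * m + 2"
    and proot: "\<And>t v. \<forall>i<m. t * v i - (\<Sum>k<m. A $$ (i, k) * v k) = poly (b i) t \<Longrightarrow>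
      poly c t + (\<Sum>i<m. cd_alpha \<gamma> n (Suc i) * (v i)\<^sup>2) + (\<Sum>i<m. ?g 0 (Suc i) * v i) = 0 \<Longrightarrow> poly p t = 0"
    by (rule quadric_elimination[OF A b c, where \<alpha> = "\<lambda>i. cd_alpha \<gamma> n (Suc i)"
        and h = "\<lambda>i. ?g 0 (Suc i)"]) blast
  obtain w where w: "\<And>t v. \<forall>i<m. t * v i - (\<Sum>k<m. A $$ (i, k) * v k) = poly (b i) t \<Longrightarrow>
      \<forall>j<m. poly (char_poly A) t * v j = poly (w j) t"
    by (rule linear_system_elimination[OF A b]) blast
  show thesis
  proof (rule that[OF p])
    show "char_poly A \<noteq> 0" "degree (char_poly A) \<le> m"
      using degree_monic_char_poly[OF A] by auto
    show "poly p (x $ 0) = 0" if x: "x \<in> roots \<gamma> n Ts r" for x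
      using proot[where v = "\<lambda>i. x $ Suc i"] sys[OF x] quad[OF x] by blast
    fix x y assume x: "x \<in> roots \<gamma> n Ts r" and y: "y \<in> roots \<gamma> n Ts r"
      and xy: "x $ 0 = y $ 0" "x \<noteq> y"
    have dim: "x \<in> carrier_vec (Suc m)" "y \<in> carrier_vec (Suc m)"
      using x y N by (auto simp: roots_def)
    obtain j where j: "j < m" "x $ Suc j \<noteq> y $ Suc j"
    proof -
      obtain i where i: "i < Suc m" "x $ i \<noteq> y $ i" using dim xy(2) by (metis carrier_vecD eq_vecI)
      then show thesis using that[of "i - 1"] xy(1) by (cases i) auto
    qed
    \<comment> \<open>Both sides equal \<open>poly (w j) (x $ 0)\<close>, because \<open>w\<close>
      does not depend on the root.\<close>
    have "poly (char_poly A) (x $ 0) * x $ Suc j = poly (char_poly A) (x $ 0) * y $ Suc j"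
      using w[OF sys[OF x]] w[OF sys[OF y]] j(1) xy(1) by simp
    then show "poly (char_poly A) (x $ 0) = 0" using j(2) by simp
  qed
qed

text \<open>With the real part fixed, the imaginary equations form a linear system. Both
  \<open>x\<close> and \<open>y\<close> solve it, so its solution set has positive dimension; the
  quadric supplies the remaining equation.\<close>

lemma roots_affine_slice:
  assumes Ts: "\<forall>T \<in> set Ts. linear_term n T" and r: "r \<in> carrier_vec (2 ^ n)"
    and x: "x \<in> roots \<gamma> n Ts r" and y: "y \<in> roots \<gamma> n Ts r" and xy: "x $ 0 = y $ 0" "x \<noteq> y"
  obtains L d where "d > 0" "affine_subspace (2 ^ n) d L"
    "quadric \<gamma> n Ts r \<inter> L = {z \<in> roots \<gamma> n Ts r. z $ 0 = x $ 0}"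
proof -
  let ?N = "2 ^ n :: nat" and ?t = "x $ 0"
  \<comment> \<open>Row 0 encodes z_0 = t. The other rows are the imaginary equations with 2 z_0
    replaced by the constant 2t, as row 0 permits.\<close>
  define B where "B = mat ?N ?N (\<lambda>(i, k). if i = 0 then if k = 0 then 1 else 0
    else linear_coeff \<gamma> n Ts i k + (if k = i then 2 * ?t else 0))"
  define c where "c = vec ?N (\<lambda>i. if i = 0 then ?t else - r $ i)"
  have B: "B \<in> carrier_mat ?N ?N" and cdim: "dim_vec c = ?N" by (simp_all add: B_def c_def)
  have sol: "B *\<^sub>v z = c \<longleftrightarrow> z $ 0 = ?t \<and>
      (\<forall>i \<in> {1..<?N}. 2 * z $ 0 * z $ i + linear_form \<gamma> n Ts i z + r $ i = 0)"
    if z: "z \<in> carrier_vec ?N" for z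
  proof -
    have Bz: "(B *\<^sub>v z) $ i = (\<Sum>k<?N. B $$ (i, k) * z $ k)" if "i < ?N" for i
      using z B that by (auto simp: scalar_prod_def lessThan_atLeast0)
    have B0: "(B *\<^sub>v z) $ 0 = z $ 0"
    proof -
      have "(B *\<^sub>v z) $ 0 = (\<Sum>k<?N. if k = 0 then z $ k else 0)"
        unfolding Bz[of 0, simplified] by (intro sum.cong) (auto simp: B_def)
      then show ?thesis by simp
    qed
    have Bi: "(B *\<^sub>v z) $ i = 2 * ?t * z $ i + linear_form \<gamma> n Ts i z" if "i \<in> {1..<?N}" for i
    proof -
      have "(B *\<^sub>v z) $ i = (\<Sum>k<?N. linear_coeff \<gamma> n Ts i k * z $ k + (if k = i then 2 * ?t * z $ k else 0))"
        using that by (subst Bz, simp) (rule sum.cong, auto simp: B_def distrib_right)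
      then show ?thesis using that by (simp add: sum.distrib linear_form_def)
    qed
    have "B *\<^sub>v z = c \<longleftrightarrow> (\<forall>i<?N. (B *\<^sub>v z) $ i = c $ i)"
      using B cdim by (intro iffI eq_vecI) (auto simp del: index_mult_mat_vec)
    also have "\<dots> \<longleftrightarrow> (B *\<^sub>v z) $ 0 = c $ 0 \<and> (\<forall>i \<in> {1..<?N}. (B *\<^sub>v z) $ i = c $ i)"
      by (rule all_less_iff_0) simp
    also have "\<dots> \<longleftrightarrow> z $ 0 = ?t \<and> (\<forall>i \<in> {1..<?N}. 2 * ?t * z $ i + linear_form \<gamma> n Ts i z + r $ i = 0)"
      unfolding B0 using Bi by (auto simp: c_def eq_neg_iff_add_eq_0)
    finally show ?thesis by auto
  qed
  have dim: "x \<in> carrier_vec ?N" "y \<in> carrier_vec ?N" using x y by (auto simp: roots_def)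
  have Bx: "B *\<^sub>v x = c" "B *\<^sub>v y = c"
    using x y xy(1) root_iff[OF Ts r] by (auto simp: sol[OF dim(1)] sol[OF dim(2)])
  obtain d where "d > 0" "affine_subspace ?N d {z \<in> carrier_vec ?N. B *\<^sub>v z = c}"
    using affine_subspace_solutions[OF B dim _ xy(2)] Bx by auto
  moreover have "quadric \<gamma> n Ts r \<inter> {z \<in> carrier_vec ?N. B *\<^sub>v z = c} =
      {z \<in> roots \<gamma> n Ts r. z $ 0 = ?t}"
    using root_iff[OF Ts r] sol by (auto simp: quadric_def)
  ultimately show thesis by (rule that)
qed

section \<open>Counting the real parts of roots\<close>

theorem theorem4p4:
  fixes \<gamma> :: "nat \<Rightarrow> 'a :: field" and n m :: nat
    and Ts :: "'a vec gen_monomial list" and r :: "'a vec"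
  assumes "CHAR('a) \<noteq> 2"
    and "\<forall>k \<in> {1..n}. \<gamma> k \<noteq> 0"
    and "m = 2 ^ n - 1"
    and "\<forall>T \<in> set Ts. linear_term n T"
    and "r \<in> carrier_vec (2 ^ n)"
  shows "finite (isolated_points \<gamma> n Ts r) \<and>
    (\<exists>\<L>. finite \<L> \<and> card \<L> \<le> m
      \<and> (\<forall>L \<in> \<L>. \<exists>d > 0. affine_subspace (m + 1) d L)
      \<and> roots \<gamma> n Ts r = isolated_points \<gamma> n Ts r \<union> (\<Union>L \<in> \<L>. quadric \<gamma> n Ts r \<inter> L)
      \<and> card (isolated_points \<gamma> n Ts r) + card \<L> \<le> 2 * m + 2)"
proof -
  have two: "(2 :: 'a) \<noteq> 0"
  proof
    assume "(2 :: 'a) = 0"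
    then have "CHAR('a) dvd 2" by (metis of_nat_eq_0_iff_char_dvd of_nat_numeral)
    moreover have "CHAR('a) \<noteq> 1" by (metis of_nat_CHAR of_nat_1 zero_neq_one)
    ultimately show False using assms(1) two_is_prime_nat prime_nat_iff by blast
  qed
  have N: "2 ^ n = m + 1" using assms(3) by simp
  define R where "R = roots \<gamma> n Ts r"
  define I where "I = isolated_points \<gamma> n Ts r"
  obtain p q where pq: "p \<noteq> 0" "degree p \<le> 2 * m + 2" "q \<noteq> 0" "degree q \<le> m"
    and p: "\<And>x. x \<in> R \<Longrightarrow> poly p (x $ 0) = 0"
    and q: "\<And>x y. x \<in> R \<Longrightarrow> y \<in> R \<Longrightarrow> x $ 0 = y $ 0 \<Longrightarrow> x \<noteq> y \<Longrightarrow> poly q (x $ 0) = 0"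
    using roots_first_coordinate[OF two assms(3-5), of \<gamma>] unfolding R_def by metis
  have I: "I = {x \<in> R. \<forall>y \<in> R. y $ 0 = x $ 0 \<longrightarrow> y = x}"
    by (simp add: I_def R_def isolated_points_def)
  \<comment> \<open>The real parts are sorted into those of isolated roots and those of all other
    roots; each element of \<open>T\<close> will yield one affine subspace.\<close>
  define S where "S = (\<lambda>x. x $ 0) ` I"
  define T where "T = (\<lambda>x. x $ 0) ` (R - I)"
  have Sp: "S \<union> T \<subseteq> {t. poly p t = 0}" using p by (auto simp: S_def T_def I)
  \<comment> \<open>A root that is not isolated has a partner with the same real part.\<close>
  have Tq: "T \<subseteq> {t. poly q t = 0}" using q by (fastforce simp: T_def I)
  have fin: "finite S" "finite T" using finite_subset[OF Sp poly_roots_finite[OF pq(1)]] by auto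
  \<comment> \<open>An isolated root shares its real part with no other root. Hence the
    cardinalities of \<open>S\<close> and \<open>T\<close> add up, and \<open>S\<close> has as many
    elements as \<open>I\<close>.\<close>
  have disj: "S \<inter> T = {}" by (auto simp: S_def T_def I) metis
  have inj: "inj_on (\<lambda>x. x $ 0) I" by (auto simp: inj_on_def I)
  have "card S + card T = card (S \<union> T)" using fin disj by (simp add: card_Un_disjoint)
  also have "\<dots> \<le> card {t. poly p t = 0}" by (intro card_mono poly_roots_finite pq Sp)
  also have "\<dots> \<le> 2 * m + 2" using card_poly_roots_bound[OF pq(1)] pq(2) by linarith
  finally have ST: "card I + card T \<le> 2 * m + 2" using inj by (simp add: S_def card_image)
  have "card T \<le> card {t. poly q t = 0}" by (intro card_mono poly_roots_finite pq Tq)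
  also have "\<dots> \<le> m" using card_poly_roots_bound[OF pq(3)] pq(4) by linarith
  finally have Tm: "card T \<le> m" .
  have "\<forall>t \<in> T. \<exists>L. (\<exists>d > 0. affine_subspace (m + 1) d L) \<and>
      quadric \<gamma> n Ts r \<inter> L = {z \<in> R. z $ 0 = t}"
  proof
    fix t assume "t \<in> T"
    then obtain x y where x: "t = x $ 0" "x \<in> R" and y: "y \<in> R" "x $ 0 = y $ 0" "x \<noteq> y"
      by (auto simp: T_def I)
    show "\<exists>L. (\<exists>d > 0. affine_subspace (m + 1) d L) \<and> quadric \<gamma> n Ts r \<inter> L = {z \<in> R. z $ 0 = t}"
      using roots_affine_slice[OF assms(4,5) x(2)[unfolded R_def] y(1)[unfolded R_def] y(2,3)]
      unfolding R_def N x(1) by metis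
  qed
  then obtain L where L: "\<forall>t \<in> T. (\<exists>d > 0. affine_subspace (m + 1) d (L t)) \<and>
      quadric \<gamma> n Ts r \<inter> L t = {z \<in> R. z $ 0 = t}" by metis
  have cL: "card (L ` T) \<le> card T" by (rule card_image_le[OF fin(2)])
  \<comment> \<open>A root outside \<open>I\<close> lies in the slice over its own real part, and
    every slice consists of roots.\<close>
  have "R = I \<union> (\<Union>t \<in> T. {z \<in> R. z $ 0 = t})" by (auto simp: T_def I)
  also have "\<dots> = I \<union> (\<Union>K \<in> L ` T. quadric \<gamma> n Ts r \<inter> K)" using L by (simp only: UN_simps(10)) simp
  finally have "R = I \<union> (\<Union>K \<in> L ` T. quadric \<gamma> n Ts r \<inter> K)" .
  moreover have "finite I" using fin(1) inj by (simp add: S_def finite_image_iff)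
  ultimately show ?thesis
    unfolding R_def[symmetric] I_def[symmetric]
    using L fin(2) cL Tm ST by (intro conjI exI[of _ "L ` T"]) auto
qed

end
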